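(* Let $\mathcal K$ be a simplicial complex on the vertex set $[m]=\{1,\dots,m\}$ (without ghost vertices) such that any two missing faces of $\mathcal K$ have a common vertex. Then there is a homotopy equivalence $$U(\mathcal K)\simeq \Sigma^2 D(\mathcal K).$$ In the case of real arrangement complements there is a homotopy equivalence $$U_{\mathbb R}(\mathcal K)\simeq \Sigma D_{\mathbb R}(\mathcal K).$$
   Context: A simplicial complex $\mathcal K$ on $[m]$ is a collection of subsets of $[m]$ containing $\varnothing$ and closed under taking subsets; "without ghost vertices" means every $\{i\}$, $i\in[m]$, belongs to $\mathcal K$. A missing face of $\mathcal K$ is a subset $I\subset[m]$ with $I\notin\mathcal K$ but every proper subset of $I$ in $\mathcal K$. For $I=\{i_1,\dots,i_k\}\subset[m]$ let $C_I=\{z\in\mathbb C^m: z_{i_1}=\dots=z_{i_k}=0\}$ (coordinate subspace) and $D_I=\{z\in\mathbb C^m: z_{i_1}=\dots=z_{i_k}\}$ (diagonal subspace). The coordinate arrangement complement is $U(\mathcal K)=\mathbb C^m\setminus\bigcup_{I\notin\mathcal K}C_I$, and the diagonal arrangement complement is $D(\mathcal K)=\mathbb C^m\setminus\bigcup_{I\notin\mathcal K}D_I$. $U_{\mathbb R}(\mathcal K)$ and $D_{\mathbb R}(\mathcal K)$ are defined in the same way with $\mathbb R^m$ in place of $\mathbb C^m$. $\Sigma$ denotes suspension. *)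

theory Defs
  imports "HOL-Analysis.Analysis"
begin

definition simplicial_complex :: "'m set set \<Rightarrow> bool" where
  "simplicial_complex K \<longleftrightarrow> {} \<in> K \<and> (\<forall>I\<in>K. \<forall>J. J \<subseteq> I \<longrightarrow> J \<in> K)"

definition no_ghost_vertices :: "'m set set \<Rightarrow> bool" where
  "no_ghost_vertices K \<longleftrightarrow> (\<forall>i. {i} \<in> K)"

definition missing_face :: "'m set set \<Rightarrow> 'm set \<Rightarrow> bool" where
  "missing_face K I \<longleftrightarrow> I \<notin> K \<and> (\<forall>J. J \<subset> I \<longrightarrow> J \<in> K)"

definition coord_subspace :: "'m set \<Rightarrow> ('a::zero ^ 'm) set" where
  "coord_subspace I = {z. \<forall>i\<in>I. z $ i = 0}"

definition diag_subspace :: "'m set \<Rightarrow> ('a ^ 'm) set" where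
  "diag_subspace I = {z. \<forall>i\<in>I. \<forall>j\<in>I. z $ i = z $ j}"

definition coord_arr_compl :: "'m set set \<Rightarrow> ('a::zero ^ 'm) set" where
  "coord_arr_compl K = UNIV - (\<Union>I\<in>{I. I \<notin> K}. coord_subspace I)"

definition diag_arr_compl :: "'m set set \<Rightarrow> ('a ^ 'm) set" where
  "diag_arr_compl K = UNIV - (\<Union>I\<in>{I. I \<notin> K}. diag_subspace I)"

text \<open>Unreduced suspension: the quotient of X \<times> [0,1] collapsing X \<times> {0} to one point
  and X \<times> {1} to another.  Points: Inl (x,t) with 0<t<1, and the two cone points
  Inr False (bottom) and Inr True (top).\<close>

definition susp_map :: "'a \<times> real \<Rightarrow> ('a \<times> real) + bool" where
  "susp_map p = (if snd p = 0 then Inr False else if snd p = 1 then Inr True else Inl p)"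

definition susp_base :: "'a topology \<Rightarrow> ('a \<times> real) topology" where
  "susp_base X = prod_topology X (top_of_set {0..1})"

definition suspension :: "'a topology \<Rightarrow> (('a \<times> real) + bool) topology" where
  "suspension X = topology (\<lambda>U. U \<subseteq> susp_map ` topspace (susp_base X) \<and>
     openin (susp_base X) {p \<in> topspace (susp_base X). susp_map p \<in> U})"

end

theory Submission
  imports Defs
begin

text \<open>Since nonfaces meet pairwise, a vector \<open>v\<close> is constant on nonfaces with at most one value \<open>g v\<close>,
  and \<open>g\<close> extends to a continuous function on \<open>F\<^sup>m\<close> (\<open>F\<close> the reals or the complex numbers)
  with \<open>g (v + c(1,\<dots>,1)) = g v + c\<close>. Retracting \<open>(v, s)\<close> to \<open>v + (s - g v)(1,\<dots>,1)\<close> identifies \<open>U(K)\<close>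
  up to homotopy with the set of all \<open>(v, s)\<close> in \<open>F\<^sup>m \<times> F\<close> such that \<open>s \<noteq> 0\<close> or \<open>v \<in> D(K)\<close>.
  When \<open>s\<close> is real, this set is two contractible half spaces joined through \<open>D(K)\<close>, hence a suspension of \<open>D(K)\<close>;
  a complex \<open>s\<close> amounts to doing this twice.\<close>

section \<open>The suspension as a quotient of the cylinder\<close>

text \<open>Preimages under \<open>susp_map\<close> commute with intersections and unions. This is
  what makes the \<open>topology\<close> constructor in \<open>suspension\<close> return the
  intended quotient topology.\<close>

lemma istopology_suspension:
  "istopology (\<lambda>U. U \<subseteq> susp_map ` topspace (susp_base X) \<and>
     openin (susp_base X) {p \<in> topspace (susp_base X). susp_map p \<in> U})"
proof -
  let ?P = "\<lambda>U. {p \<in> topspace (susp_base X). susp_map p \<in> U}"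
  have Int: "?P (S \<inter> T) = ?P S \<inter> ?P T" for S T
    by auto
  have Union: "?P (\<Union>\<K>) = \<Union>(?P ` \<K>)" for \<K>
    by auto
  show ?thesis
    unfolding istopology_def Int Union
  proof (intro conjI allI impI)
    fix \<K>
    assume "\<forall>U\<in>\<K>. U \<subseteq> susp_map ` topspace (susp_base X) \<and> openin (susp_base X) (?P U)"
    then show "\<Union>\<K> \<subseteq> susp_map ` topspace (susp_base X)" "openin (susp_base X) (\<Union>(?P ` \<K>))"
      by (blast, intro openin_Union ballI) blast
  qed (blast, simp add: openin_Int)
qed

lemma openin_suspension:
  "openin (suspension X) U \<longleftrightarrow> U \<subseteq> susp_map ` topspace (susp_base X) \<and>
     openin (susp_base X) {p \<in> topspace (susp_base X). susp_map p \<in> U}"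
  unfolding suspension_def by (simp add: topology_inverse' istopology_suspension)

lemma topspace_suspension: "topspace (suspension X) = susp_map ` topspace (susp_base X)"
proof
  show "topspace (suspension X) \<subseteq> susp_map ` topspace (susp_base X)"
    using openin_suspension openin_topspace by blast
  have "{p \<in> topspace (susp_base X). susp_map p \<in> susp_map ` topspace (susp_base X)} = topspace (susp_base X)"
    by auto
  then have "openin (suspension X) (susp_map ` topspace (susp_base X))"
    by (simp add: openin_suspension)
  then show "susp_map ` topspace (susp_base X) \<subseteq> topspace (suspension X)"
    by (rule openin_subset)
qed

lemma topspace_susp_base: "topspace (susp_base X) = topspace X \<times> {0..1}"
  by (simp add: susp_base_def)

lemma quotient_map_susp_map: "quotient_map (susp_base X) (suspension X) susp_map"
  unfolding quotient_map_def by (auto simp: topspace_suspension openin_suspension)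

lemma continuous_map_susp_map: "continuous_map (susp_base X) (suspension X) susp_map"
  by (simp add: quotient_imp_continuous_map quotient_map_susp_map)

lemma continuous_map_from_suspension:
  "continuous_map (suspension X) Z f \<longleftrightarrow> continuous_map (susp_base X) Z (f \<circ> susp_map)"
  using continuous_compose_quotient_map_eq [OF quotient_map_susp_map] by blast

lemma susp_map_eq_iff:
  assumes "t \<in> {0..1}" "t' \<in> {0..1}"
  shows "susp_map (x, t) = susp_map (x', t') \<longleftrightarrow> t = t' \<and> (x = x' \<or> t = 0 \<or> t = 1)"
  using assms by (auto simp: susp_map_def)

section \<open>Homotopies out of a suspension\<close>

text \<open>An instance of Whitehead's theorem: the product of a quotient map with the identity of a
  locally compact Hausdorff space is a quotient map.\<close>

lemma quotient_map_Times_susp_map: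
  "quotient_map (prod_topology (top_of_set {0..1::real}) (susp_base X))
     (prod_topology (top_of_set {0..1}) (suspension X)) (\<lambda>(r, p). (r, susp_map p))"
proof (rule quotient_map_prod_right)
  show "locally_compact_space (top_of_set {0..1::real})"
    by (simp add: compact_imp_locally_compact_space compact_space_subtopology)
  show "Hausdorff_space (top_of_set {0..1::real}) \<or> regular_space (top_of_set {0..1::real})"
    by (simp add: Hausdorff_space_subtopology)
qed (rule quotient_map_susp_map)

text \<open>The product of a quotient map with the identity of a compact interval is again a quotient map,
  so a homotopy on the suspension may be given on the cylinder.\<close>

lemma homotopic_from_suspension:
  fixes k :: "real \<times> 'a \<times> real \<Rightarrow> 'b"
  assumes cont: "continuous_map (prod_topology (top_of_set {0..1}) (susp_base X)) Z k"
    and bot: "\<And>r x y. \<lbrakk>r \<in> {0..1}; x \<in> topspace X; y \<in> topspace X\<rbrakk> \<Longrightarrow> k (r, (x, 0)) = k (r, (y, 0))"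
    and top: "\<And>r x y. \<lbrakk>r \<in> {0..1}; x \<in> topspace X; y \<in> topspace X\<rbrakk> \<Longrightarrow> k (r, (x, 1)) = k (r, (y, 1))"
    and f: "\<And>x t. \<lbrakk>x \<in> topspace X; t \<in> {0..1}\<rbrakk> \<Longrightarrow> k (0, (x, t)) = f (susp_map (x, t))"
    and g: "\<And>x t. \<lbrakk>x \<in> topspace X; t \<in> {0..1}\<rbrakk> \<Longrightarrow> k (1, (x, t)) = g (susp_map (x, t))"
  shows "homotopic_with (\<lambda>_. True) (suspension X) Z f g"
proof -
  let ?B = "prod_topology (top_of_set {0..1::real}) (susp_base X)"
  have fibres: "k p = k q"
    if "p \<in> topspace ?B" "q \<in> topspace ?B"
      "(\<lambda>(r, p). (r, susp_map p)) p = (\<lambda>(r, p). (r, susp_map p)) q" for p q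
  proof -
    obtain r x t r' y t' where pq: "p = (r, (x, t))" "q = (r', (y, t'))"
      by (metis prod.exhaust)
    then have "r = r'" "t = t'" "r \<in> {0..1}" "x \<in> topspace X" "y \<in> topspace X" "x = y \<or> t = 0 \<or> t = 1"
      using that by (auto simp: topspace_susp_base susp_map_eq_iff)
    then show ?thesis
      using bot [of r x y] top [of r x y] pq by metis
  qed
  obtain h where h: "continuous_map (prod_topology (top_of_set {0..1}) (suspension X)) Z h"
    and hk: "\<And>p. p \<in> topspace ?B \<Longrightarrow> h ((\<lambda>(r, p). (r, susp_map p)) p) = k p"
    by (rule quotient_map_lift_exists [OF quotient_map_Times_susp_map cont fibres]) auto
  have hk': "h (r, susp_map (x, t)) = k (r, (x, t))"
    if "r \<in> {0..1}" "x \<in> topspace X" "t \<in> {0..1}" for r x t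
    using hk [of "(r, (x, t))"] that by (simp add: topspace_susp_base)
  have "h (0, q) = f q \<and> h (1, q) = g q" if "q \<in> topspace (suspension X)" for q
  proof -
    obtain x t where "q = susp_map (x, t)" "x \<in> topspace X" "t \<in> {0..1}"
      using \<open>q \<in> topspace (suspension X)\<close> by (auto simp: topspace_suspension topspace_susp_base)
    then show ?thesis
      by (simp add: hk' f g)
  qed
  then show ?thesis
    using h by (subst homotopic_with) (simp, blast)
qed

section \<open>Functoriality and homotopy invariance of the suspension\<close>

definition susp_fun :: "('a \<Rightarrow> 'b) \<Rightarrow> ('a \<times> real) + bool \<Rightarrow> ('b \<times> real) + bool" where
  "susp_fun f = map_sum (map_prod f id) id"

lemma susp_fun_susp_map: "susp_fun f (susp_map (x, t)) = susp_map (f x, t)"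
  by (simp add: susp_fun_def susp_map_def)

lemma susp_fun_compose: "susp_fun (g \<circ> f) = susp_fun g \<circ> susp_fun f"
proof (rule ext)
  show "susp_fun (g \<circ> f) q = (susp_fun g \<circ> susp_fun f) q" for q
    by (cases q) (auto simp: susp_fun_def)
qed

lemma susp_fun_id: "susp_fun id = id"
  by (simp add: susp_fun_def prod.map_id0 sum.map_id0)

lemma continuous_map_susp_fun:
  assumes "continuous_map X Y f"
  shows "continuous_map (suspension X) (suspension Y) (susp_fun f)"
proof -
  have "continuous_map (susp_base X) (susp_base Y) (\<lambda>p. (f (fst p), snd p))"
    unfolding susp_base_def
    by (intro continuous_map_pairedI continuous_map_snd continuous_map_compose[OF continuous_map_fst assms, unfolded o_def])
  then have "continuous_map (susp_base X) (suspension Y) (susp_map \<circ> (\<lambda>p. (f (fst p), snd p)))"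
    by (rule continuous_map_compose [OF _ continuous_map_susp_map])
  moreover have "susp_map \<circ> (\<lambda>p. (f (fst p), snd p)) = susp_fun f \<circ> susp_map"
    by (auto simp: susp_fun_susp_map)
  ultimately show ?thesis
    by (simp add: continuous_map_from_suspension)
qed

text \<open>Run the given homotopy at every height of the cylinder. Heights do not change, so the
  two ends go to the poles at all times.\<close>

lemma homotopic_susp_fun:
  assumes "homotopic_with (\<lambda>_. True) X Y f g"
  shows "homotopic_with (\<lambda>_. True) (suspension X) (suspension Y) (susp_fun f) (susp_fun g)"
proof -
  obtain h where h: "continuous_map (prod_topology (top_of_set {0..1::real}) X) Y h"
    and h0: "\<And>x. h (0, x) = f x" and h1: "\<And>x. h (1, x) = g x"
    using assms by (auto simp: homotopic_with_def)
  let ?k = "\<lambda>q. (h (fst q, fst (snd q)), snd (snd q))"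
  let ?B = "prod_topology (top_of_set {0..1::real}) (susp_base X)"
  have fst: "continuous_map ?B (top_of_set {0..1}) fst"
    by (rule continuous_map_fst)
  have snd: "continuous_map ?B X (\<lambda>q. fst (snd q))" "continuous_map ?B (top_of_set {0..1}) (\<lambda>q. snd (snd q))"
    unfolding susp_base_def
    by (rule continuous_map_compose [OF continuous_map_snd continuous_map_fst, unfolded o_def]
             continuous_map_compose [OF continuous_map_snd continuous_map_snd, unfolded o_def])+
  have "continuous_map ?B (susp_base Y) ?k"
    using continuous_map_compose [OF continuous_map_pairedI [OF fst snd(1)] h] snd(2)
    unfolding susp_base_def [of Y] by (intro continuous_map_pairedI) (auto simp: o_def)
  from continuous_map_compose [OF this continuous_map_susp_map]
  have "continuous_map ?B (suspension Y) (susp_map \<circ> ?k)" .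
  then show ?thesis
    by (rule homotopic_from_suspension) (auto simp: h0 h1 susp_fun_def susp_map_def)
qed

text \<open>Functoriality carries the homotopy inverse over. In the complex case this replaces the
  space inside the outer suspension.\<close>

lemma suspension_homotopy_equivalent:
  assumes "X homotopy_equivalent_space Y"
  shows "suspension X homotopy_equivalent_space suspension Y"
proof -
  obtain f g where fg: "continuous_map X Y f" "continuous_map Y X g"
    "homotopic_with (\<lambda>x. True) X X (g \<circ> f) id" "homotopic_with (\<lambda>x. True) Y Y (f \<circ> g) id"
    using assms by (auto simp: homotopy_equivalent_space_def)
  show ?thesis
    unfolding homotopy_equivalent_space_def
    using fg(1,2) [THEN continuous_map_susp_fun] fg(3,4) [THEN homotopic_susp_fun]
    unfolding susp_fun_compose susp_fun_id by blast
qed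

section \<open>Slit spaces over an open set\<close>

text \<open>Take the distance to the complement, capped at 1. The cap later ensures that heights 1
  and -1 are sent to the poles over every base point.\<close>

lemma open_eq_positive_set:
  fixes Y :: "'a::metric_space set"
  assumes "open Y"
  obtains \<delta> :: "'a \<Rightarrow> real" where "continuous_on UNIV \<delta>" "\<And>v. 0 \<le> \<delta> v" "\<And>v. \<delta> v \<le> 1"
    "\<And>v. v \<in> Y \<longleftrightarrow> 0 < \<delta> v"
\<comment> \<open>\<open>infdist\<close> to the empty set is 0 by convention, so the whole space
  needs its own function.\<close>
proof (cases "Y = UNIV")
  case True
  then show ?thesis
    using that [of "\<lambda>_. 1"] by simp
next
  case False
  then have "v \<in> - Y \<longleftrightarrow> infdist v (- Y) = 0" for v
    using assms by (intro in_closed_iff_infdist_zero) auto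
  then have "v \<in> Y \<longleftrightarrow> 0 < infdist v (- Y)" for v
    using infdist_nonneg [of v "- Y"] by (metis ComplD ComplI order_le_less less_irrefl)
  then show ?thesis
    by (intro that [of "\<lambda>v. min 1 (infdist v (- Y))"])
      (simp_all add: infdist_nonneg continuous_on_min continuous_on_infdist)
qed

text \<open>The product space with the wall \<open>s = 0\<close> removed except for the window
  \<open>Y\<close>. For real \<open>s\<close> these are two open half spaces joined through
  \<open>Y\<close>.\<close>

definition slit :: "'a set \<Rightarrow> ('a \<times> 'b::zero) set" where
  "slit Y = {(v, s). s \<noteq> 0 \<or> v \<in> Y}"

lemma mem_slit [simp]: "(v, s) \<in> slit Y \<longleftrightarrow> s \<noteq> 0 \<or> v \<in> Y"
  by (simp add: slit_def)

lemma slit_nonempty: "Y \<noteq> {} \<Longrightarrow> slit Y \<noteq> {}"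
  by (auto simp: slit_def)

text \<open>Openness lets the construction be iterated: in the complex case a slit space is itself
  the window.\<close>

lemma open_slit:
  fixes Y :: "'a::topological_space set"
  assumes "open Y"
  shows "open (slit Y :: ('a \<times> 'b::{zero,t1_space}) set)"
proof -
  have "slit Y = Y \<times> UNIV \<union> UNIV \<times> - {0 :: 'b}"
    by (auto simp: slit_def)
  then show ?thesis
    using assms by (auto intro!: open_Un open_Times)
qed

section \<open>A real slit space is a suspension of its window\<close>

text \<open>Over \<open>v\<close> with \<open>\<delta> v > 0\<close>, the affine map from the
  interval between \<open>- \<delta> v\<close> and \<open>\<delta> v\<close> onto the unit interval,
  clamped outside.\<close>

definition susp_height :: "('a \<Rightarrow> real) \<Rightarrow> 'a \<times> real \<Rightarrow> real" where
  "susp_height \<delta> p = (1 + max (- 1) (min 1 (snd p / \<delta> (fst p)))) / 2"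

text \<open>Collapses what lies at or beyond height \<open>\<delta>\<close> on either side to a
  pole. Over points outside the window \<open>\<delta>\<close> is 0, so there the sign of the height
  chooses the pole.\<close>

definition slit_to_susp :: "('a \<Rightarrow> real) \<Rightarrow> 'a \<times> real \<Rightarrow> ('a \<times> real) + bool" where
  "slit_to_susp \<delta> p = (if \<delta> (fst p) \<le> snd p then Inr True
     else if snd p \<le> - \<delta> (fst p) then Inr False
     else Inl (fst p, (1 + snd p / \<delta> (fst p)) / 2))"

lemma susp_height_bounds: "susp_height \<delta> p \<in> {0..1}"
  by (auto simp: susp_height_def)

lemma slit_to_susp_eq_susp_map:
  assumes "0 < \<delta> v"
  shows "slit_to_susp \<delta> (v, s) = susp_map (v, susp_height \<delta> (v, s))"
proof -
  have "1 \<le> s / \<delta> v \<longleftrightarrow> \<delta> v \<le> s" "s / \<delta> v \<le> - 1 \<longleftrightarrow> s \<le> - \<delta> v"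
    using assms by (auto simp: field_simps)
  then show ?thesis
    using assms by (auto simp: slit_to_susp_def susp_map_def susp_height_def max_def min_def)
qed

text \<open>Paste over three open sets: strictly above \<open>\<delta>\<close>, strictly below
  \<open>- \<delta>\<close>, and over \<open>Y\<close>. The map is constant on the first two and
  passes through the cylinder on the third.\<close>

lemma continuous_map_slit_to_susp:
  fixes Y :: "'a::real_normed_vector set"
  assumes \<delta>: "continuous_on UNIV \<delta>" "\<And>v. 0 \<le> \<delta> v" "\<And>v. v \<in> Y \<longleftrightarrow> 0 < \<delta> v" and "Y \<noteq> {}"
  shows "continuous_map (top_of_set (slit Y)) (suspension (top_of_set Y)) (slit_to_susp \<delta>)"
proof -
  let ?W = "slit Y :: ('a \<times> real) set"
  define T where "T i = (if i = 0 then {p \<in> ?W. \<delta> (fst p) < snd p}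
    else if i = 1 then {p \<in> ?W. snd p < - \<delta> (fst p)} else {p \<in> ?W. 0 < \<delta> (fst p)})" for i :: nat
  define F where "F i = (if i = 0 then (\<lambda>p. Inr True) else if i = 1 then (\<lambda>p. Inr False)
    else (\<lambda>p. susp_map (fst p, susp_height \<delta> p)))" for i :: nat
  have \<delta>': "continuous_on S (\<lambda>p. \<delta> (fst p))" for S :: "('a \<times> real) set"
    by (rule continuous_on_compose2 [OF \<delta>(1)]) (auto intro: continuous_intros)
  \<comment> \<open>The poles are images of cylinder points, so they belong to the suspension only
    because \<open>Y\<close> is nonempty.\<close>
  have poles: "Inr b \<in> topspace (suspension (top_of_set Y))" for b
  proof -
    obtain y where "y \<in> Y"
      using \<open>Y \<noteq> {}\<close> by auto
    then have "susp_map (y, if b then 1 else 0) \<in> topspace (suspension (top_of_set Y))"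
      by (auto simp: topspace_suspension topspace_susp_base)
    then show ?thesis
      by (simp add: susp_map_def split: if_splits)
  qed
  show ?thesis
  proof (rule pasting_lemma [where I = "{0, 1, 2}" and T = T and f = F])
    fix i :: nat
    assume "i \<in> {0, 1, 2}"
    have "open {p. \<delta> (fst p) < snd p}" "open {p. snd p < - \<delta> (fst p)}" "open {p :: 'a \<times> real. 0 < \<delta> (fst p)}"
      by (intro open_Collect_less \<delta>' continuous_intros)+
    then show "openin (top_of_set ?W) (T i)"
      by (auto simp: T_def openin_open Collect_conj_eq)
    have "continuous_map (top_of_set (T 2)) (susp_base (top_of_set Y)) (\<lambda>p. (fst p, susp_height \<delta> p))"
      unfolding susp_base_def susp_height_def
      by (auto simp: T_def \<delta>(3) intro!: continuous_map_pairedI continuous_intros \<delta>')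
    from continuous_map_compose [OF this continuous_map_susp_map]
    have "continuous_map (top_of_set (T 2)) (suspension (top_of_set Y)) (F 2)"
      by (simp add: F_def o_def)
    moreover have "continuous_map (top_of_set (T i)) (suspension (top_of_set Y)) (F i)" if "i \<noteq> 2"
      using that poles \<open>i \<in> {0, 1, 2}\<close> by (auto simp: F_def)
    moreover have "subtopology (top_of_set ?W) (T i) = top_of_set (T i)"
      by (auto simp: subtopology_subtopology T_def Int_absorb1 intro!: arg_cong [of _ _ "top_of_set"])
    ultimately show "continuous_map (subtopology (top_of_set ?W) (T i)) (suspension (top_of_set Y)) (F i)"
      by metis
  next
    have F: "F i (v, s) = slit_to_susp \<delta> (v, s)" if vs: "(v, s) \<in> T i" "i \<in> {0, 1, 2}" for i v s
    proof -
      consider "i = 0" "\<delta> v < s" | "i = 1" "s < - \<delta> v" | "i = 2" "0 < \<delta> v"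
        using vs by (auto simp: T_def split: if_splits)
      then show ?thesis
      proof cases
        case 2
        then show ?thesis
          using \<delta>(2) [of v] by (simp add: F_def slit_to_susp_def)
      qed (auto simp: F_def slit_to_susp_eq_susp_map, simp add: slit_to_susp_def)
    qed
    fix i j :: nat and p
    assume "i \<in> {0, 1, 2}" "j \<in> {0, 1, 2}" "p \<in> topspace (top_of_set ?W) \<inter> T i \<inter> T j"
    then show "F i p = F j p"
      using F by (cases p) auto
  next
    fix p
    assume "p \<in> topspace (top_of_set ?W)"
    then obtain v s where p: "p = (v, s)" "s \<noteq> 0 \<or> v \<in> Y"
      by (cases p) auto
    show "\<exists>j. j \<in> {0, 1, 2} \<and> p \<in> T j \<and> slit_to_susp \<delta> p = F j p"
    proof (cases "0 < \<delta> v")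
      case True
      then show ?thesis
        using p by (auto simp: T_def F_def slit_to_susp_eq_susp_map intro!: exI [of _ 2])
    next
      case False
      then have "\<delta> v = 0" "s \<noteq> 0"
        using \<delta>(2) [of v] \<delta>(3) [of v] p by auto
      then show ?thesis
        using p by (cases "s > 0") (auto simp: T_def F_def slit_to_susp_def intro: exI [of _ 0] exI [of _ 1])
    qed
  qed
qed

text \<open>The map \<open>\<psi>\<close> collapses the far parts of the half spaces; its homotopy
  inverse \<open>\<phi>\<close> places the cylinder in the slit space and cones its ends off to one
  point in each half space.\<close>

lemma slit_homotopy_equivalent_suspension:
  fixes Y :: "'a::real_normed_vector set"
  assumes "open Y" "Y \<noteq> {}"
  shows "top_of_set (slit Y :: ('a \<times> real) set) homotopy_equivalent_space suspension (top_of_set Y)"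
proof -
  let ?W = "slit Y :: ('a \<times> real) set" and ?S = "suspension (top_of_set Y)"
  obtain \<delta> :: "'a \<Rightarrow> real" where \<delta>: "continuous_on UNIV \<delta>" "\<And>v. 0 \<le> \<delta> v" "\<And>v. \<delta> v \<le> 1"
    "\<And>v. v \<in> Y \<longleftrightarrow> 0 < \<delta> v"
    using open_eq_positive_set [OF \<open>open Y\<close>] by metis
  define \<psi> where "\<psi> = slit_to_susp \<delta>"
  have \<psi>: "continuous_map (top_of_set ?W) ?S \<psi>"
    unfolding \<psi>_def using \<delta> \<open>Y \<noteq> {}\<close> by (intro continuous_map_slit_to_susp)
  have base: "susp_base (top_of_set Y) = top_of_set (Y \<times> {0..1})"
    by (simp add: susp_base_def flip: subtopology_Times)
  have cyl: "prod_topology (top_of_set {0..1::real}) (susp_base (top_of_set Y)) = top_of_set ({0..1} \<times> Y \<times> {0..1})"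
    by (simp add: base flip: subtopology_Times)
  \<comment> \<open>The scaling factor is 1 at the middle, so height 0 is met only inside
    \<open>Y\<close>, and it is 0 at both ends, so each end collapses to a point as the suspension
    requires.\<close>
  define \<phi>\<^sub>0 :: "'a \<times> real \<Rightarrow> 'a \<times> real"
    where "\<phi>\<^sub>0 p = ((1 - \<bar>2 * snd p - 1\<bar>) *\<^sub>R fst p, 2 * snd p - 1)" for p
  have "continuous_map (susp_base (top_of_set Y)) (top_of_set ?W) \<phi>\<^sub>0"
    unfolding base by (auto simp: \<phi>\<^sub>0_def intro!: continuous_intros)
  moreover have "\<phi>\<^sub>0 p = \<phi>\<^sub>0 q" if "p \<in> topspace (susp_base (top_of_set Y))" "q \<in> topspace (susp_base (top_of_set Y))"
    "susp_map p = susp_map q" for p q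
    using that by (cases p; cases q) (auto simp: \<phi>\<^sub>0_def topspace_susp_base susp_map_eq_iff)
  ultimately obtain \<phi> where \<phi>: "continuous_map ?S (top_of_set ?W) \<phi>"
    and \<phi>_eq: "\<And>p. p \<in> topspace (susp_base (top_of_set Y)) \<Longrightarrow> \<phi> (susp_map p) = \<phi>\<^sub>0 p"
    by (metis quotient_map_lift_exists [OF quotient_map_susp_map])
  have \<phi>_Inl: "\<phi> (Inl (y, t)) = ((1 - \<bar>2 * t - 1\<bar>) *\<^sub>R y, 2 * t - 1)" if "y \<in> Y" "0 < t" "t < 1" for y t
    using that \<phi>_eq [of "(y, t)"] by (simp add: topspace_susp_base susp_map_def \<phi>\<^sub>0_def)
  have \<phi>_Inr: "\<phi> (Inr b) = (0, if b then 1 else - 1)" for b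
  proof -
    obtain y where "y \<in> Y"
      using \<open>Y \<noteq> {}\<close> by auto
    then show ?thesis
      using \<phi>_eq [of "(y, if b then 1 else 0)"]
      by (cases b) (simp_all add: topspace_susp_base susp_map_def \<phi>\<^sub>0_def)
  qed
  have "homotopic_with (\<lambda>_. True) (top_of_set ?W) (top_of_set ?W) (\<phi> \<circ> \<psi>) id"
  proof (rule homotopic_with_linear)
    show "continuous_on ?W (\<phi> \<circ> \<psi>)"
      using continuous_map_compose [OF \<psi> \<phi>] by simp
    fix p
    assume "p \<in> ?W"
    then obtain v s where p: "p = (v, s)" "s \<noteq> 0 \<or> v \<in> Y"
      by (cases p) auto
    \<comment> \<open>These facts keep the segment in the slit space: heights of equal nonzero sign
      never average to 0, and a point at height 0 does not move.\<close>
    obtain b where b: "snd (\<phi> (\<psi> (v, s))) = b" and sgn: "sgn b = sgn s"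
      and s0: "s = 0 \<Longrightarrow> \<phi> (\<psi> (v, s)) = (v, s)"
    proof (cases "\<bar>s\<bar> < \<delta> v")
      case True
      then have "v \<in> Y" "-1 < s / \<delta> v" "s / \<delta> v < 1"
        using \<delta>(4) [of v] by (auto simp: field_simps)
      define t where "t = (1 + s / \<delta> v) / 2"
      have t: "2 * t - 1 = s / \<delta> v" "0 < t" "t < 1"
        using \<open>-1 < s / \<delta> v\<close> \<open>s / \<delta> v < 1\<close> by (simp_all add: t_def field_simps)
      have "\<psi> (v, s) = Inl (v, t)"
        using True by (auto simp: \<psi>_def slit_to_susp_def t_def)
      then have "\<phi> (\<psi> (v, s)) = ((1 - \<bar>s / \<delta> v\<bar>) *\<^sub>R v, s / \<delta> v)"
        using \<phi>_Inl [OF \<open>v \<in> Y\<close> t(2,3)] unfolding t(1) by simp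
      moreover have "sgn (s / \<delta> v) = sgn s"
        using True by (auto simp: sgn_if zero_less_divide_iff)
      ultimately show ?thesis
        by (intro that [of "s / \<delta> v"]) (simp_all only: snd_conv, simp)
    next
      case False
      then have "s \<noteq> 0" "\<psi> (v, s) = Inr (0 < s)"
        using p \<delta>(2) [of v] \<delta>(4) [of v] by (auto simp: \<psi>_def slit_to_susp_def)
      then show ?thesis
        using that by (simp add: \<phi>_Inr sgn_if)
    qed
    show "closed_segment ((\<phi> \<circ> \<psi>) p) (id p) \<subseteq> ?W"
    proof
      fix q
      assume "q \<in> closed_segment ((\<phi> \<circ> \<psi>) p) (id p)"
      then obtain u where u: "0 \<le> u" "u \<le> 1" and q: "q = (1 - u) *\<^sub>R \<phi> (\<psi> (v, s)) + u *\<^sub>R (v, s)"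
        by (auto simp: p closed_segment_def)
      show "q \<in> ?W"
      proof (cases "s = 0")
        case True
        then have "q = (v, s)"
          using s0 q by (simp flip: scaleR_left_distrib)
        then show ?thesis
          using p by simp
      next
        case False
        have "snd q = (1 - u) * b + u * s"
          using q b by simp
        also have "\<dots> \<noteq> 0"
          \<comment> \<open>The bound is an upper one, so positive heights are treated through their
            negatives.\<close>
          using u convex_bound_lt [of "-b" 0 "-s" "1 - u" u] convex_bound_lt [of b 0 s "1 - u" u] sgn False
          by (auto simp: sgn_if split: if_splits)
        finally show ?thesis
          by (cases q) simp
      qed
    qed
  qed (auto simp: continuous_on_id)
  moreover have "homotopic_with (\<lambda>_. True) ?S ?S (\<psi> \<circ> \<phi>) id"
  proof -
    \<comment> \<open>An intermediate map between \<open>\<psi> \<circ> \<phi>\<close> and the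
      identity: it omits the scaling of the base point and only distorts heights.\<close>
    define \<kappa> where "\<kappa> q = (case q of Inl p \<Rightarrow> \<psi> (fst p, 2 * snd p - 1) | Inr b \<Rightarrow> Inr b)" for q
    have pole1: "\<psi> (v, 1) = Inr True" for v
      using \<delta>(3) [of v] by (simp add: \<psi>_def slit_to_susp_def)
    have pole0: "\<psi> (v, - 1) = Inr False" for v
      using \<delta>(2,3) [of v] by (simp add: \<psi>_def slit_to_susp_def)
    have \<kappa>: "\<kappa> (susp_map (y, t)) = \<psi> (y, 2 * t - 1)" for y t
      by (simp add: \<kappa>_def susp_map_def pole0 pole1)
    have "homotopic_with (\<lambda>_. True) ?S ?S \<kappa> (\<psi> \<circ> \<phi>)"
    proof (rule homotopic_from_suspension)
      \<comment> \<open>Turns the scaling on gradually. At the ends the base point still varies, but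
        \<open>\<psi>\<close> sends it to the pole all the same.\<close>
      let ?k = "\<lambda>q. ((1 - fst q * \<bar>2 * snd (snd q) - 1\<bar>) *\<^sub>R fst (snd q), 2 * snd (snd q) - 1)"
      have "continuous_map (prod_topology (top_of_set {0..1}) (susp_base (top_of_set Y))) (top_of_set ?W) ?k"
        unfolding cyl by (auto intro!: continuous_intros)
      from continuous_map_compose [OF this \<psi>]
      show "continuous_map (prod_topology (top_of_set {0..1}) (susp_base (top_of_set Y))) ?S (\<psi> \<circ> ?k)" .
    qed (auto simp: \<kappa> pole0 pole1 \<phi>_eq \<phi>\<^sub>0_def topspace_susp_base)
    moreover have "homotopic_with (\<lambda>_. True) ?S ?S \<kappa> id"
    proof (rule homotopic_from_suspension)
      \<comment> \<open>Over a fixed base point in \<open>Y\<close>, both \<open>\<kappa>\<close>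
        and the identity are given by a height in the unit interval, so the heights are interpolated
        linearly. They agree at the ends.\<close>
      let ?h = "\<lambda>q :: real \<times> 'a \<times> real. susp_height \<delta> (fst (snd q), 2 * snd (snd q) - 1)"
      let ?k = "\<lambda>q. (fst (snd q), (1 - fst q) * ?h q + fst q * snd (snd q))"
      have "continuous_on ({0..1} \<times> Y \<times> {0..1}) (\<lambda>q :: real \<times> 'a \<times> real. \<delta> (fst (snd q)))"
        by (rule continuous_on_compose2 [OF \<delta>(1)]) (auto intro!: continuous_intros)
      then have "continuous_on ({0..1} \<times> Y \<times> {0..1}) ?h"
        unfolding susp_height_def using \<delta>(4) by (auto intro!: continuous_intros)
      moreover have "(1 - u) * susp_height \<delta> p + u * t \<in> {0..1}" if "u \<in> {0..1}" "t \<in> {0..1}" for u p t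
        using that susp_height_bounds [of \<delta> p] convex_bound_le [of "susp_height \<delta> p" 1 t "1 - u" u] by auto
      ultimately have "continuous_map (prod_topology (top_of_set {0..1}) (susp_base (top_of_set Y)))
          (susp_base (top_of_set Y)) ?k"
        unfolding cyl base by (auto intro!: continuous_intros)
      from continuous_map_compose [OF this continuous_map_susp_map]
      show "continuous_map (prod_topology (top_of_set {0..1}) (susp_base (top_of_set Y))) ?S (susp_map \<circ> ?k)" .
      have h: "susp_height \<delta> (y, 1) = 1" "susp_height \<delta> (y, - 1) = 0" if "y \<in> Y" for y
        using that \<delta>(3) [of y] \<delta>(4) [of y] by (auto simp: susp_height_def field_simps)
      show "(susp_map \<circ> ?k) (r, (x, 0)) = (susp_map \<circ> ?k) (r, (y, 0))"
        "(susp_map \<circ> ?k) (r, (x, 1)) = (susp_map \<circ> ?k) (r, (y, 1))"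
        if "x \<in> topspace (top_of_set Y)" "y \<in> topspace (top_of_set Y)" for r x y
        using that by (simp_all add: h susp_map_def)
      show "(susp_map \<circ> ?k) (0, (x, t)) = \<kappa> (susp_map (x, t))" if "x \<in> topspace (top_of_set Y)" for x t
        using that \<delta>(4) [of x] by (simp add: \<kappa> \<psi>_def slit_to_susp_eq_susp_map)
    qed auto
    ultimately show ?thesis
      by (metis homotopic_with_symD homotopic_with_trans)
  qed
  ultimately show ?thesis
    unfolding homotopy_equivalent_space_def using \<phi> \<psi> by blast
qed

section \<open>Arrangement complements\<close>

lemma mem_coord_arr_compl: "z \<in> coord_arr_compl K \<longleftrightarrow> (\<forall>I. I \<notin> K \<longrightarrow> (\<exists>i\<in>I. z $ i \<noteq> 0))"
  by (auto simp: coord_arr_compl_def coord_subspace_def)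

lemma mem_diag_arr_compl:
  "z \<in> diag_arr_compl K \<longleftrightarrow> (\<forall>I. I \<notin> K \<longrightarrow> (\<exists>i\<in>I. \<exists>j\<in>I. z $ i \<noteq> z $ j))"
  by (auto simp: diag_arr_compl_def diag_subspace_def)

lemma open_diag_arr_compl: "open (diag_arr_compl K :: ('a::t2_space ^ 'm::finite) set)"
proof -
  have "diag_arr_compl K = (\<Inter>I\<in>- K. \<Union>i\<in>I. \<Union>j\<in>I. {z :: 'a ^ 'm. z $ i \<noteq> z $ j})"
    by (auto simp: mem_diag_arr_compl)
  also have "open \<dots>"
    by (intro open_INT open_UN ballI open_Collect_neq continuous_on_component continuous_on_id finite)
  finally show ?thesis .
qed

text \<open>The empty set and all singletons are faces, so every nonface has two vertices, and a
  vector with pairwise distinct coordinates avoids all the diagonals.\<close>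

lemma diag_arr_compl_nonempty:
  assumes "simplicial_complex (K :: 'm::finite set set)" "no_ghost_vertices K"
  shows "(diag_arr_compl K :: ('a::semiring_char_0 ^ 'm) set) \<noteq> {}"
proof -
  obtain f :: "'m \<Rightarrow> nat" where f: "inj f"
    using finite_imp_inj_to_nat_seg [OF finite, of "UNIV :: 'm set"] by auto
  have "\<exists>i\<in>I. \<exists>j\<in>I. i \<noteq> j" if "I \<notin> K" for I
  proof -
    have "I \<noteq> {}" "\<And>i. I \<noteq> {i}"
      using assms that by (auto simp: simplicial_complex_def no_ghost_vertices_def)
    then show ?thesis
      by (metis equals0I singleton_iff subset_antisym subsetI)
  qed
  then have "(\<chi> i. (of_nat (f i) :: 'a)) \<in> diag_arr_compl K"
    using f by (simp add: mem_diag_arr_compl inj_eq)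
  then show ?thesis
    by blast
qed

text \<open>The map \<open>e\<close> embeds the coordinate complement as the graph of
  \<open>g\<close>, and \<open>r\<close> translates along the all-ones vector until \<open>g\<close>
  equals the height. Such translations preserve the diagonal complement, so the straight homotopy at
  fixed height stays in the slit space.\<close>

lemma coord_arr_compl_homotopy_equivalent_slit:
  fixes g :: "('a::real_normed_vector ^ 'm::finite) \<Rightarrow> 'a"
  assumes cont: "continuous_on UNIV g"
    and shift: "\<And>v c. g (\<chi> i. v $ i + c) = g v + c"
    and level: "\<And>v I c. \<lbrakk>I \<notin> K; \<And>i. i \<in> I \<Longrightarrow> v $ i = c\<rbrakk> \<Longrightarrow> g v = c"
  shows "top_of_set (coord_arr_compl K :: ('a ^ 'm) set) homotopy_equivalent_space
    top_of_set (slit (diag_arr_compl K) :: (('a ^ 'm) \<times> 'a) set)"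
proof -
  let ?U = "coord_arr_compl K :: ('a ^ 'm) set"
    and ?W = "slit (diag_arr_compl K) :: (('a ^ 'm) \<times> 'a) set"
  define r :: "('a ^ 'm) \<times> 'a \<Rightarrow> 'a ^ 'm" where "r p = (\<chi> i. fst p $ i + (snd p - g (fst p)))" for p
  define e :: "'a ^ 'm \<Rightarrow> ('a ^ 'm) \<times> 'a" where "e u = (u, g u)" for u
  have gr: "g (r p) = snd p" for p
    by (simp add: r_def shift)
  have diag_shift: "(\<chi> i. v $ i + c) \<in> diag_arr_compl K \<longleftrightarrow> v \<in> diag_arr_compl K" for v :: "'a ^ 'm" and c
    by (simp add: mem_diag_arr_compl)
  have "r p \<in> ?U" if "p \<in> ?W" for p
  proof (rule ccontr)
    assume "r p \<notin> ?U"
    then obtain I where I: "I \<notin> K" "\<And>i. i \<in> I \<Longrightarrow> r p $ i = 0"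
      by (auto simp: mem_coord_arr_compl)
    \<comment> \<open>Vanishing on a nonface forces \<open>g (r p) = 0\<close> by
      \<open>level\<close>, and \<open>gr\<close> identifies this value with the height of
      \<open>p\<close>.\<close>
    then have "snd p = 0" "r p \<notin> diag_arr_compl K"
      using level [of I "r p" 0] gr [of p] by (auto simp: mem_diag_arr_compl)
    then show False
      using that diag_shift [of "fst p" "snd p - g (fst p)"] by (cases p) (simp add: r_def)
  qed
  moreover have "e u \<in> ?W" if "u \<in> ?U" for u
  proof (rule ccontr)
    assume "e u \<notin> ?W"
    then obtain I where "I \<notin> K" "\<And>i j. \<lbrakk>i \<in> I; j \<in> I\<rbrakk> \<Longrightarrow> u $ i = u $ j" "g u = 0"
      by (auto simp: e_def mem_diag_arr_compl)
    \<comment> \<open>The common value of \<open>u\<close> on the nonface equals \<open>g u\<close>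
      by \<open>level\<close>, hence it is 0.\<close>
    then have "\<And>i. i \<in> I \<Longrightarrow> u $ i = 0"
      using level [of I u] by metis
    then show False
      using that \<open>I \<notin> K\<close> by (auto simp: mem_coord_arr_compl)
  qed
  moreover have contr: "continuous_on S r" for S
    unfolding r_def by (auto intro!: continuous_intros continuous_on_compose2 [OF cont])
  moreover have conte: "continuous_on S e" for S
    unfolding e_def by (auto intro!: continuous_intros continuous_on_subset [OF cont])
  moreover have "r (e u) = u" for u
    by (simp add: r_def e_def vec_eq_iff)
  ultimately have "retraction_maps (top_of_set ?W) (top_of_set ?U) r e"
    by (auto simp: retraction_maps_def)
  moreover have "homotopic_with (\<lambda>_. True) (top_of_set ?W) (top_of_set ?W) (e \<circ> r) id"
  proof (rule homotopic_with_linear)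
    show "continuous_on ?W (e \<circ> r)"
      using contr conte by (rule continuous_on_compose)
    fix p
    assume p: "p \<in> ?W"
    show "closed_segment ((e \<circ> r) p) (id p) \<subseteq> ?W"
    proof
      fix q
      assume "q \<in> closed_segment ((e \<circ> r) p) (id p)"
      then obtain u where "q = (1 - u) *\<^sub>R (r p, snd p) + u *\<^sub>R p"
        by (auto simp: closed_segment_def e_def gr)
      then have "q = ((\<chi> i. fst p $ i + (1 - u) *\<^sub>R (snd p - g (fst p))), snd p)"
        by (cases p) (simp add: r_def vec_eq_iff algebra_simps)
      then show "q \<in> ?W"
        using p diag_shift by (cases p) simp
    qed
  qed (simp add: continuous_on_id)
  ultimately show ?thesis
    by (metis deformation_retraction_imp_homotopy_equivalent_space homotopy_equivalent_space_sym)
qed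

section \<open>Nonfaces and level functions\<close>

text \<open>Missing faces are the minimal nonfaces. This extends the common-vertex hypothesis from
  missing faces to all nonfaces.\<close>

lemma nonface_contains_missing_face:
  fixes K :: "'m::finite set set"
  assumes "I \<notin> K"
  obtains J where "J \<subseteq> I" "missing_face K J"
proof -
  have "\<exists>J\<subseteq>I. missing_face K J"
    using finite [of I] assms
  proof (induction I rule: finite_psubset_induct)
    case (psubset A)
    then show ?case
      unfolding missing_face_def by (metis order_refl psubset_imp_subset subset_trans)
  qed
  then show ?thesis
    using that by blast
qed

lemma continuous_on_Max:
  fixes f :: "'i \<Rightarrow> 'a::topological_space \<Rightarrow> real"
  assumes "finite I" "I \<noteq> {}" "\<And>i. i \<in> I \<Longrightarrow> continuous_on S (f i)"
  shows "continuous_on S (\<lambda>x. Max ((\<lambda>i. f i x) ` I))"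
  using assms by (induction I rule: finite_ne_induct) (auto intro!: continuous_on_max)

lemma continuous_on_Min:
  fixes f :: "'i \<Rightarrow> 'a::topological_space \<Rightarrow> real"
  assumes "finite I" "I \<noteq> {}" "\<And>i. i \<in> I \<Longrightarrow> continuous_on S (f i)"
  shows "continuous_on S (\<lambda>x. Min ((\<lambda>i. f i x) ` I))"
  using assms by (induction I rule: finite_ne_induct) (auto intro!: continuous_on_min)

text \<open>If the coordinates of \<open>v\<close> are all \<open>c\<close> on some nonface, then, as it meets every other nonface,
  every maximum below is at least \<open>c\<close>, with equality for that nonface.\<close>

lemma exists_level_function_real:
  fixes K :: "'m::finite set set"
  assumes "{} \<in> K" and meet: "\<And>I J. \<lbrakk>I \<notin> K; J \<notin> K\<rbrakk> \<Longrightarrow> I \<inter> J \<noteq> {}"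
  obtains g :: "real ^ 'm \<Rightarrow> real" where "continuous_on UNIV g"
    "\<And>v c. g (\<chi> i. v $ i + c) = g v + c"
    "\<And>v I c. \<lbrakk>I \<notin> K; \<And>i. i \<in> I \<Longrightarrow> v $ i = c\<rbrakk> \<Longrightarrow> g v = c"
proof (cases "K = UNIV")
  \<comment> \<open>Without nonfaces the level condition is vacuous and the minimum would range over
    the empty set; any coordinate serves instead.\<close>
  case True
  then show ?thesis
    by (intro that [of "\<lambda>v. v $ undefined"]) (auto intro!: continuous_intros)
next
  case False
  define h :: "real ^ 'm \<Rightarrow> 'm set \<Rightarrow> real" where "h v I = Max ((\<lambda>i. v $ i) ` I)" for v I
  \<comment> \<open>Finite minima and maxima are continuous and commute with adding a constant,
    which gives continuity and the shift rule.\<close>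
  define g :: "real ^ 'm \<Rightarrow> real" where "g v = Min (h v ` (- K))" for v
  have ne: "I \<noteq> {}" if "I \<notin> K" for I
    using that \<open>{} \<in> K\<close> by auto
  have "- K \<noteq> {}"
    using False by auto
  have "continuous_on UNIV g"
    unfolding g_def h_def using ne \<open>- K \<noteq> {}\<close>
    by (intro continuous_on_Min continuous_on_Max continuous_intros) auto
  moreover have "g (\<chi> i. v $ i + c) = g v + c" for v c
  proof -
    have "h (\<chi> i. v $ i + c) ` (- K) = (\<lambda>I. h v I + c) ` (- K)"
      unfolding h_def by (rule image_cong) (auto simp: ne Max_add_commute)
    then show ?thesis
      using \<open>- K \<noteq> {}\<close> by (simp add: g_def Min_add_commute)
  qed
  moreover have "g v = c" if I: "I \<notin> K" "\<And>i. i \<in> I \<Longrightarrow> v $ i = c" for v I c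
  proof -
    have "(\<lambda>i. v $ i) ` I = {c}"
      using I ne [of I] by force
    then have "h v I = c"
      by (simp add: h_def)
    moreover have "c \<le> h v J" if J: "J \<notin> K" for J
    proof -
      obtain i where "i \<in> I" "i \<in> J"
        using meet [OF I(1) J] by auto
      then show ?thesis
        using I(2) [of i] by (auto simp: h_def intro: Max_ge)
    qed
    ultimately show ?thesis
      using I(1) by (auto simp: g_def intro!: Min_eqI)
  qed
  ultimately show ?thesis
    using that by blast
qed

text \<open>Both the shift rule and the level condition split into real and imaginary parts, so the
  real function is applied to each part separately.\<close>

lemma exists_level_function_complex:
  fixes K :: "'m::finite set set"
  assumes "{} \<in> K" "\<And>I J. \<lbrakk>I \<notin> K; J \<notin> K\<rbrakk> \<Longrightarrow> I \<inter> J \<noteq> {}"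
  obtains g :: "complex ^ 'm \<Rightarrow> complex" where "continuous_on UNIV g"
    "\<And>v c. g (\<chi> i. v $ i + c) = g v + c"
    "\<And>v I c. \<lbrakk>I \<notin> K; \<And>i. i \<in> I \<Longrightarrow> v $ i = c\<rbrakk> \<Longrightarrow> g v = c"
proof -
  obtain g :: "real ^ 'm \<Rightarrow> real" where cont: "continuous_on UNIV g"
    and shift: "\<And>v c. g (\<chi> i. v $ i + c) = g v + c"
    and level: "\<And>v I c. \<lbrakk>I \<notin> K; \<And>i. i \<in> I \<Longrightarrow> v $ i = c\<rbrakk> \<Longrightarrow> g v = c"
    using exists_level_function_real [OF assms] by blast
  define G :: "complex ^ 'm \<Rightarrow> complex"
    where "G v = Complex (g (\<chi> i. Re (v $ i))) (g (\<chi> i. Im (v $ i)))" for v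
  show ?thesis
  proof
    show "continuous_on UNIV G"
      unfolding G_def Complex_eq by (auto intro!: continuous_intros continuous_on_compose2 [OF cont])
    show "G (\<chi> i. v $ i + c) = G v + c" for v c
      using shift [of "\<chi> i. Re (v $ i)" "Re c"] shift [of "\<chi> i. Im (v $ i)" "Im c"]
      by (simp add: G_def complex_eq_iff)
    show "G v = c" if "I \<notin> K" "\<And>i. i \<in> I \<Longrightarrow> v $ i = c" for v I c
      using level [OF that(1), of "\<chi> i. Re (v $ i)" "Re c"] level [OF that(1), of "\<chi> i. Im (v $ i)" "Im c"] that(2)
      by (simp add: G_def complex_eq_iff)
  qed
qed

text \<open>A complex height is nonzero exactly when its imaginary or its real part is. The real
  part becomes the inner height, the imaginary part the outer one.\<close>

lemma slit_complex_homeomorphic_slit_slit: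
  fixes Y :: "'a::real_normed_vector set"
  shows "top_of_set (slit Y :: ('a \<times> complex) set) homeomorphic_space
    top_of_set (slit (slit Y :: ('a \<times> real) set) :: (('a \<times> real) \<times> real) set)"
proof -
  let ?f = "\<lambda>p. ((fst p, Re (snd p)), Im (snd p))"
  let ?g = "\<lambda>q. (fst (fst q), Complex (snd (fst q)) (snd q))"
  have "homeomorphic_maps (top_of_set (slit Y)) (top_of_set (slit (slit Y))) ?f ?g"
    unfolding homeomorphic_maps_def
    by (auto simp: Complex_eq complex_eq_iff intro!: continuous_intros)
  then show ?thesis
    unfolding homeomorphic_space_def by blast
qed

section \<open>The complex and the real equivalence\<close>

theorem theorem4p6:
  fixes K :: "'m::finite set set"
  assumes "simplicial_complex K"
    and "no_ghost_vertices K"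
    and "\<forall>I J. missing_face K I \<and> missing_face K J \<longrightarrow> I \<inter> J \<noteq> {}"
  shows "(top_of_set (coord_arr_compl K :: (complex ^ 'm) set) homotopy_equivalent_space
           suspension (suspension (top_of_set (diag_arr_compl K :: (complex ^ 'm) set)))) \<and>
         (top_of_set (coord_arr_compl K :: (real ^ 'm) set) homotopy_equivalent_space
           suspension (top_of_set (diag_arr_compl K :: (real ^ 'm) set)))"
proof -
  have "{} \<in> K"
    using assms(1) by (simp add: simplicial_complex_def)
  have meet: "I \<inter> J \<noteq> {}" if nonfaces: "I \<notin> K" "J \<notin> K" for I J
  proof -
    obtain I' J' where "I' \<subseteq> I" "missing_face K I'" "J' \<subseteq> J" "missing_face K J'"
      using nonfaces nonface_contains_missing_face by metis
    then show ?thesis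
      using assms(3) by blast
  qed
  let ?D\<^sub>C = "diag_arr_compl K :: (complex ^ 'm) set" and ?D\<^sub>R = "diag_arr_compl K :: (real ^ 'm) set"
  have D\<^sub>C: "open ?D\<^sub>C" "?D\<^sub>C \<noteq> {}" and D\<^sub>R: "open ?D\<^sub>R" "?D\<^sub>R \<noteq> {}"
    by (rule open_diag_arr_compl diag_arr_compl_nonempty [OF assms(1,2)])+
  obtain g\<^sub>C :: "complex ^ 'm \<Rightarrow> complex" where g\<^sub>C: "continuous_on UNIV g\<^sub>C"
    "\<And>v c. g\<^sub>C (\<chi> i. v $ i + c) = g\<^sub>C v + c"
    "\<And>v I c. \<lbrakk>I \<notin> K; \<And>i. i \<in> I \<Longrightarrow> v $ i = c\<rbrakk> \<Longrightarrow> g\<^sub>C v = c"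
    using exists_level_function_complex [OF \<open>{} \<in> K\<close> meet] by blast
  obtain g\<^sub>R :: "real ^ 'm \<Rightarrow> real" where g\<^sub>R: "continuous_on UNIV g\<^sub>R"
    "\<And>v c. g\<^sub>R (\<chi> i. v $ i + c) = g\<^sub>R v + c"
    "\<And>v I c. \<lbrakk>I \<notin> K; \<And>i. i \<in> I \<Longrightarrow> v $ i = c\<rbrakk> \<Longrightarrow> g\<^sub>R v = c"
    using exists_level_function_real [OF \<open>{} \<in> K\<close> meet] by blast
  have "top_of_set (coord_arr_compl K :: (complex ^ 'm) set) homotopy_equivalent_space
      top_of_set (slit ?D\<^sub>C :: ((complex ^ 'm) \<times> complex) set)"
    using g\<^sub>C by (rule coord_arr_compl_homotopy_equivalent_slit)
  also have "\<dots> homotopy_equivalent_space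
      top_of_set (slit (slit ?D\<^sub>C :: ((complex ^ 'm) \<times> real) set) :: (((complex ^ 'm) \<times> real) \<times> real) set)"
    by (rule homeomorphic_imp_homotopy_equivalent_space [OF slit_complex_homeomorphic_slit_slit])
  \<comment> \<open>The outer slit is resolved first, with the inner slit space as its window; the
    inner one is then resolved under the suspension.\<close>
  also have "\<dots> homotopy_equivalent_space suspension (top_of_set (slit ?D\<^sub>C :: ((complex ^ 'm) \<times> real) set))"
    by (rule slit_homotopy_equivalent_suspension [OF open_slit [OF D\<^sub>C(1)] slit_nonempty [OF D\<^sub>C(2)]])
  also have "\<dots> homotopy_equivalent_space suspension (suspension (top_of_set ?D\<^sub>C))"
    by (rule suspension_homotopy_equivalent [OF slit_homotopy_equivalent_suspension [OF D\<^sub>C]])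
  finally have complex: "top_of_set (coord_arr_compl K :: (complex ^ 'm) set) homotopy_equivalent_space
      suspension (suspension (top_of_set ?D\<^sub>C))" .
  have "top_of_set (coord_arr_compl K :: (real ^ 'm) set) homotopy_equivalent_space
      top_of_set (slit ?D\<^sub>R :: ((real ^ 'm) \<times> real) set)"
    using g\<^sub>R by (rule coord_arr_compl_homotopy_equivalent_slit)
  also have "\<dots> homotopy_equivalent_space suspension (top_of_set ?D\<^sub>R)"
    by (rule slit_homotopy_equivalent_suspension [OF D\<^sub>R])
  finally show ?thesis
    using complex by blast
qed

end
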